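(* Let $c\ge 0$ and consider the utility-constrained surplus maximization problem with utility bound $c$ and optimal value $g(c)$. If $c\ge\mathbf E[v]$, any solution that gives the item to all types and charges a constant in $[-c+\mathbf E[v],0]$ is optimal. Otherwise, the solution is a randomization over two prices $p_1\le p_2$: there are $p_1\le p_2$ and $\alpha\in[0,1]$ such that an optimal allocation is $x(v)=0$ for $v\le p_1$, $x(v)=\alpha$ for $p_1\le v\le p_2$, and $x(v)=1$ otherwise. If the function $S_U$ is concave, the solution is simply to post a deterministic price, that is, $p_1=p_2$. In either case, there exists an optimal solution that satisfies the upper bound $c$ on expected utility with equality. Additionally, $g(c)$ is a concave function of $c$.
   Context: A value $v$ is drawn from a distribution with density $f$ with support $[\underline v,\bar v]$, where $\underline v=0<\bar v<\infty$. The utility-constrained surplus maximization problem with bound $c$ is: over functions $x(v)\in[0,1]$, $p(v)\in\mathbb R$, maximize $\mathbf E_{v\sim f}[vx(v)]$ subject to (IC) $vx(v)-p(v)\ge vx(v')-p(v')$ for all $v,v'$; (IR) $vx(v)-p(v)\ge0$ for all $v$; and $\mathbf E_{v\sim f}[vx(v)-p(v)]\le c$. Its optimal value is $g(c)$. For a price $p\in[\underline v,\bar v]$, let $u(p)=\int_{v\ge p}(v-p)f(v)\,dv$ and $S(p)=\int_{v\ge p}vf(v)\,dv$ be the expected utility and surplus of posting price $p$. For $c\in[0,\mathbf E[v]]$ let $p(c)=u^{-1}(c)$ be the price giving the buyer expected utility $c$, and let $S_U(c):=S(p(c))$. Randomizing over prices $p_1\le p_2$ means posting $p_1$ with probability $\alpha$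 and $p_2$ with probability $1-\alpha$. *)

theory Defs
  imports "HOL-Probability.Probability"
begin

text \<open>The support of a Borel measure in the topological sense. The density itself may vanish at
  individual points of the support.\<close>

definition measure_support :: "'a::topological_space measure \<Rightarrow> 'a set" where
  "measure_support M = {x. \<forall>U. open U \<and> x \<in> U \<longrightarrow> 0 < emeasure M U}"

definition density_with_support :: "(real \<Rightarrow> real) \<Rightarrow> real \<Rightarrow> bool" where
  "density_with_support f vbar \<longleftrightarrow>
     f \<in> borel_measurable borel \<and> (\<forall>v. 0 \<le> f v) \<and>
     prob_space (density lborel (\<lambda>v. ennreal (f v))) \<and>
     measure_support (density lborel (\<lambda>v. ennreal (f v))) = {0..vbar}"

text \<open>The type space is the interval from 0 to \<open>vbar\<close>. Allocations \<open>x\<close> and payments \<open>p\<close> are total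
  functions whose values outside the type space are ignored everywhere, so the expectation
  is an integral over that interval only.\<close>

definition expect :: "(real \<Rightarrow> real) \<Rightarrow> real \<Rightarrow> (real \<Rightarrow> real) \<Rightarrow> real" where
  "expect f vbar h = (LINT v:{0..vbar}|lborel. h v * f v)"

definition incentive_compatible :: "real \<Rightarrow> (real \<Rightarrow> real) \<Rightarrow> (real \<Rightarrow> real) \<Rightarrow> bool" where
  "incentive_compatible vbar x p \<longleftrightarrow>
     (\<forall>v\<in>{0..vbar}. \<forall>v'\<in>{0..vbar}. v * x v - p v \<ge> v * x v' - p v')"

definition individually_rational :: "real \<Rightarrow> (real \<Rightarrow> real) \<Rightarrow> (real \<Rightarrow> real) \<Rightarrow> bool" where
  "individually_rational vbar x p \<longleftrightarrow> (\<forall>v\<in>{0..vbar}. v * x v - p v \<ge> 0)"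

definition exp_surplus :: "(real \<Rightarrow> real) \<Rightarrow> real \<Rightarrow> (real \<Rightarrow> real) \<Rightarrow> real" where
  "exp_surplus f vbar x = expect f vbar (\<lambda>v. v * x v)"

definition exp_utility ::
    "(real \<Rightarrow> real) \<Rightarrow> real \<Rightarrow> (real \<Rightarrow> real) \<Rightarrow> (real \<Rightarrow> real) \<Rightarrow> real" where
  "exp_utility f vbar x p = expect f vbar (\<lambda>v. v * x v - p v)"

text \<open>No measurability condition is needed: incentive compatibility makes \<open>x\<close> nondecreasing and the
  indirect utility convex on the type space, so with \<open>x\<close> between 0 and 1 all the integrals exist.\<close>

definition feasible ::
    "(real \<Rightarrow> real) \<Rightarrow> real \<Rightarrow> real \<Rightarrow> (real \<Rightarrow> real) \<Rightarrow> (real \<Rightarrow> real) \<Rightarrow> bool" where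
  "feasible f vbar c x p \<longleftrightarrow>
     (\<forall>v\<in>{0..vbar}. 0 \<le> x v \<and> x v \<le> 1) \<and>
     incentive_compatible vbar x p \<and> individually_rational vbar x p \<and>
     exp_utility f vbar x p \<le> c"

definition optimal ::
    "(real \<Rightarrow> real) \<Rightarrow> real \<Rightarrow> real \<Rightarrow> (real \<Rightarrow> real) \<Rightarrow> (real \<Rightarrow> real) \<Rightarrow> bool" where
  "optimal f vbar c x p \<longleftrightarrow>
     feasible f vbar c x p \<and>
     (\<forall>x' p'. feasible f vbar c x' p' \<longrightarrow> exp_surplus f vbar x' \<le> exp_surplus f vbar x)"

definition opt_value :: "(real \<Rightarrow> real) \<Rightarrow> real \<Rightarrow> real \<Rightarrow> real" where
  "opt_value f vbar c = Sup {exp_surplus f vbar x | x p. feasible f vbar c x p}"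

definition price_utility :: "(real \<Rightarrow> real) \<Rightarrow> real \<Rightarrow> real" where
  "price_utility f q = (LINT v:{q..}|lborel. (v - q) * f v)"

definition price_surplus :: "(real \<Rightarrow> real) \<Rightarrow> real \<Rightarrow> real" where
  "price_surplus f q = (LINT v:{q..}|lborel. v * f v)"

definition price_of_utility :: "(real \<Rightarrow> real) \<Rightarrow> real \<Rightarrow> real \<Rightarrow> real" where
  "price_of_utility f vbar c = the_inv_into {0..vbar} (price_utility f) c"

definition surplus_of_utility :: "(real \<Rightarrow> real) \<Rightarrow> real \<Rightarrow> real \<Rightarrow> real" where
  "surplus_of_utility f vbar c = price_surplus f (price_of_utility f vbar c)"

text \<open>A type equal to the posted price is indifferent, and here does not buy.\<close>

definition posted_alloc :: "real \<Rightarrow> real \<Rightarrow> real" where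
  "posted_alloc q v = (if v \<le> q then 0 else 1)"

definition posted_payment :: "real \<Rightarrow> real \<Rightarrow> real" where
  "posted_payment q v = (if v \<le> q then 0 else q)"

definition two_price_alloc :: "real \<Rightarrow> real \<Rightarrow> real \<Rightarrow> real \<Rightarrow> real" where
  "two_price_alloc \<alpha> p1 p2 v = (if v \<le> p1 then 0 else if v \<le> p2 then \<alpha> else 1)"

definition two_price_payment :: "real \<Rightarrow> real \<Rightarrow> real \<Rightarrow> real \<Rightarrow> real" where
  "two_price_payment \<alpha> p1 p2 v = \<alpha> * posted_payment p1 v + (1 - \<alpha>) * posted_payment p2 v"

lemma two_price_alloc_randomization:
  assumes "p1 \<le> p2"
  shows "two_price_alloc \<alpha> p1 p2 v = \<alpha> * posted_alloc p1 v + (1 - \<alpha>) * posted_alloc p2 v"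
  using assms by (auto simp: two_price_alloc_def posted_alloc_def)

lemma two_price_same:
  "two_price_alloc \<alpha> q q = posted_alloc q" "two_price_payment \<alpha> q q = posted_payment q"
  by (auto simp: fun_eq_iff two_price_alloc_def two_price_payment_def posted_alloc_def
      posted_payment_def algebra_simps)

end

theory Submission
  imports Defs
begin

text \<open>Incentive compatibility makes \<open>x\<close> a subgradient of the indirect utility, which therefore dominates
  its value at 0 plus the primitive of \<open>x\<close>. By Fubini, the surplus minus \<open>lam\<close> times the expected utility is
  then at most the integral of \<open>x\<close> against a weight that does not depend on the mechanism, and by the second
  mean value theorem this is the same expression for some posted price. So a multiplier \<open>lam \<ge> 0\<close> that
  bounds the posted prices bounds all mechanisms. For \<open>0 < c < E[v]\<close>, take the best randomization over
  two prices with expected utility \<open>c\<close>, which exists by compactness; the multiplier is the slope of a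
  supporting line there, obtained by comparing the slopes of chords. For \<open>c = 0\<close> the supporting line may
  be vertical, but there every feasible mechanism has surplus 0. Concavity of the optimal value follows by
  mixing mechanisms.\<close>

section \<open>Exchange of integrals, subgradients and supports of measures\<close>

text \<open>The product of \<open>g\<close> with \<open>B\<close> times the indicator of
  \<open>{0..b}\<close> dominates the integrand, which justifies Fubini below.\<close>

lemma integrable_iterated_integrand:
  fixes y g :: "real \<Rightarrow> real"
  assumes g: "integrable lborel g" and y: "y \<in> borel_measurable borel"
    and B: "\<And>z. z \<in> {0..b} \<Longrightarrow> \<bar>y z\<bar> \<le> B"
  shows "integrable (lborel \<Otimes>\<^sub>M lborel)
    (\<lambda>(v, z). indicator {0..b} v * g v * (indicator {0..v} z * y z))"
proof -
  have [measurable]: "g \<in> borel_measurable borel" using g by auto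
  note [measurable] = y
  have "integrable (lborel \<Otimes>\<^sub>M lborel) (\<lambda>(v, z). g v * (indicator {0..b} z * B))"
  proof (rule lborel_pair.Fubini_integrable)
    show "(\<lambda>(v, z). g v * (indicator {0..b} z * B)) \<in> borel_measurable (lborel \<Otimes>\<^sub>M lborel)"
      by measurable
    show "integrable lborel (\<lambda>v. LINT z|lborel. norm (case (v, z) of (v, z) \<Rightarrow> g v * (indicator {0..b} z * B)))"
      using g by (auto simp: abs_mult)
    show "AE v in lborel. integrable lborel (\<lambda>z. case (v, z) of (v, z) \<Rightarrow> g v * (indicator {0..b} z * B))"
      by (auto intro!: AE_I2 integrable_mult_left integrable_real_indicator emeasure_bounded_finite)
  qed
  then show ?thesis
  proof (rule Bochner_Integration.integrable_bound)
    \<comment> \<open>The interval \<open>{0..v}\<close> moves with \<open>v\<close>; stated as a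
      condition on the pair, its indicator is jointly measurable.\<close>
    have "indicator {0..b} v = (if 0 \<le> v \<and> v \<le> b then 1 else 0::real)"
      "indicator {0..v} z = (if 0 \<le> z \<and> z \<le> v then 1 else 0::real)" for v z
      by auto
    then show "(\<lambda>(v, z). indicator {0..b} v * g v * (indicator {0..v} z * y z)) \<in> borel_measurable (lborel \<Otimes>\<^sub>M lborel)"
      by simp
    show "AE w in lborel \<Otimes>\<^sub>M lborel. norm (case w of (v, z) \<Rightarrow> indicator {0..b} v * g v * (indicator {0..v} z * y z))
       \<le> norm (case w of (v, z) \<Rightarrow> g v * (indicator {0..b} z * B))"
    proof (rule AE_I2, clarify)
      fix v z :: real
      show "norm (indicator {0..b} v * g v * (indicator {0..v} z * y z)) \<le> norm (g v * (indicator {0..b} z * B))"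
        using B[of z] by (auto simp: indicator_def abs_mult intro!: mult_left_mono)
    qed
  qed
qed

text \<open>Both sides integrate over the triangle \<open>0 \<le> z \<le> v \<le> b\<close>, in
  opposite orders. This is integration by parts without any continuity of \<open>y\<close> or
  \<open>g\<close>.\<close>

lemma integral_primitive_times_density:
  fixes y g :: "real \<Rightarrow> real"
  assumes g: "integrable lborel g" and y: "y \<in> borel_measurable borel"
    and B: "\<And>z. z \<in> {0..b} \<Longrightarrow> \<bar>y z\<bar> \<le> B"
  shows "(LINT v:{0..b}|lborel. (LINT z:{0..v}|lborel. y z) * g v) =
         (LINT z:{0..b}|lborel. y z * (LINT v:{z..b}|lborel. g v))"
    and "set_integrable lborel {0..b} (\<lambda>v. (LINT z:{0..v}|lborel. y z) * g v)"
proof -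
  let ?h = "\<lambda>v z. indicator {0..b} v * g v * (indicator {0..v} z * y z)"
  note int = integrable_iterated_integrand[OF assms]
  have "(LINT v:{0..b}|lborel. (LINT z:{0..v}|lborel. y z) * g v) = (LINT v|lborel. LINT z|lborel. ?h v z)"
    unfolding set_lebesgue_integral_def by (intro Bochner_Integration.integral_cong) auto
  also have "\<dots> = (LINT z|lborel. LINT v|lborel. ?h v z)"
    by (rule lborel_pair.Fubini_integral[OF int, symmetric])
  also have "\<dots> = (LINT z|lborel. LINT v|lborel. indicator {0..b} z * y z * (indicator {z..b} v * g v))"
    by (intro Bochner_Integration.integral_cong) (auto simp: indicator_def)
  also have "\<dots> = (LINT z:{0..b}|lborel. y z * (LINT v:{z..b}|lborel. g v))"
    unfolding set_lebesgue_integral_def by (intro Bochner_Integration.integral_cong) auto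
  finally show "(LINT v:{0..b}|lborel. (LINT z:{0..v}|lborel. y z) * g v) =
         (LINT z:{0..b}|lborel. y z * (LINT v:{z..b}|lborel. g v))" .
  have "integrable lborel (\<lambda>v. LINT z|lborel. ?h v z)"
    using lborel_pair.integrable_fst[OF int] by simp
  moreover have "(\<lambda>v. LINT z|lborel. ?h v z) =
      (\<lambda>v. indicator {0..b} v *\<^sub>R ((LINT z:{0..v}|lborel. y z) * g v))"
    by (simp add: fun_eq_iff set_lebesgue_integral_def)
  ultimately show "set_integrable lborel {0..b} (\<lambda>v. (LINT z:{0..v}|lborel. y z) * g v)"
    by (simp add: set_integrable_def)
qed

text \<open>The error term \<open>x b - x a\<close> times the mesh telescopes over a uniform partition.\<close>

lemma integral_subgradient_le:
  fixes U x :: "real \<Rightarrow> real"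
  assumes sub: "\<And>v w. v \<in> {a..b} \<Longrightarrow> w \<in> {a..b} \<Longrightarrow> U w + x w * (v - w) \<le> U v"
    and mono: "mono_on {a..b} x" and "a \<le> b"
  shows "U a + integral {a..b} x \<le> U b"
proof -
  have int: "x integrable_on {a..b}" using mono by (rule integrable_on_mono_on)
  \<comment> \<open>The integral is at most the right value of \<open>x\<close> times the length,
    and \<open>U\<close> grows by at least the left value times the length.\<close>
  have step: "U t - U s + integral {t..s} x \<le> (x s - x t) * (s - t)"
    if "t \<in> {a..b}" "s \<in> {a..b}" "t \<le> s" for s t
  proof -
    have i: "x integrable_on {t..s}" by (rule integrable_on_subinterval[OF int]) (use that in auto)
    have "integral {t..s} x \<le> integral {t..s} (\<lambda>_. x s)"
      by (rule integral_le[OF i]) (use that mono in \<open>auto intro: mono_onD\<close>)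
    also have "\<dots> = x s * (s - t)" using that by simp
    finally have "integral {t..s} x \<le> x s * (s - t)" .
    moreover have "U t + x t * (s - t) \<le> U s" using sub that by auto
    ultimately show ?thesis by (simp add: algebra_simps)
  qed
  have bound: "U a - U b + integral {a..b} x \<le> (x b - x a) * (b - a) / real (Suc n)" for n
  proof -
    define d where "d = (b - a) / real (Suc n)"
    define t where "t i = a + real i * d" for i
    have d0: "0 \<le> d" using \<open>a \<le> b\<close> by (simp add: d_def)
    have tb: "t (Suc n) = b" "t 0 = a" by (auto simp: t_def d_def)
    have mem: "t i \<in> {a..b}" if "i \<le> Suc n" for i
    proof -
      have "real i * d \<le> real (Suc n) * d" using that d0 by (intro mult_right_mono) auto
      then show ?thesis using tb d0 by (auto simp: t_def)
    qed
    have "U a - U (t i) + integral {a..t i} x \<le> (x (t i) - x a) * d" if "i \<le> Suc n" for i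
      using that
    proof (induction i)
      case 0 then show ?case by (simp add: tb)
    next
      case (Suc i)
      have "t (Suc i) - t i = d" by (simp add: t_def algebra_simps)
      moreover have le: "t i \<le> t (Suc i)" using d0 by (simp add: t_def algebra_simps)
      moreover have "integral {a..t i} x + integral {t i..t (Suc i)} x = integral {a..t (Suc i)} x"
        using mem[of i] mem[of "Suc i"] Suc.prems le
        by (intro Henstock_Kurzweil_Integration.integral_combine integrable_on_subinterval[OF int]) auto
      moreover have "U a - U (t i) + integral {a..t i} x \<le> (x (t i) - x a) * d" using Suc by simp
      ultimately show ?case using step[of "t i" "t (Suc i)"] mem[of i] mem[of "Suc i"] Suc.prems
        by (simp add: algebra_simps)
    qed
    from this[of "Suc n"] show ?thesis by (simp add: tb d_def)
  qed
  have "(\<lambda>n. (x b - x a) * (b - a) / real (Suc n)) \<longlonglongrightarrow> 0"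
    by (rule LIMSEQ_Suc[OF lim_const_over_n])
  then have "U a - U b + integral {a..b} x \<le> 0"
    by (rule LIMSEQ_le_const) (use bound in auto)
  then show ?thesis by simp
qed

text \<open>The complement of the support is a union of open null sets, possibly uncountable; by
  Lindelof countably many of them already cover it.\<close>

lemma AE_in_measure_support:
  fixes M :: "'a::second_countable_topology measure"
  assumes "sets M = sets borel"
  shows "AE x in M. x \<in> measure_support M"
proof -
  define \<F> where "\<F> = {U. open U \<and> emeasure M U = 0}"
  obtain \<F>' where F: "\<F>' \<subseteq> \<F>" "countable \<F>'" "\<Union>\<F>' = \<Union>\<F>"
    using Lindelof[of \<F>] unfolding \<F>_def by auto
  have "\<Union>\<F>' \<in> null_sets M"
    using F(1,2) assms by (intro null_sets_UN'[where N = id, simplified])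
      (auto simp: \<F>_def null_sets_def)
  moreover have "- measure_support M = \<Union>\<F>"
    by (auto simp: measure_support_def \<F>_def)
  ultimately show ?thesis using F(3) by (intro AE_I'[of "\<Union>\<F>'"]) auto
qed

section \<open>Tail probabilities and posted prices\<close>

locale value_density =
  fixes f :: "real \<Rightarrow> real" and vbar :: real
  assumes vbar_pos: "0 < vbar" and density: "density_with_support f vbar"
begin

lemma borel_f [measurable]: "f \<in> borel_measurable borel"
  and f_nonneg: "0 \<le> f v"
  using density by (auto simp: density_with_support_def)

lemma nn_integral_f: "(\<integral>\<^sup>+ v. ennreal (f v) \<partial>lborel) = 1"
proof -
  interpret prob_space "density lborel (\<lambda>v. ennreal (f v))"
    using density by (simp add: density_with_support_def)
  show ?thesis using emeasure_space_1 by (simp add: emeasure_density)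
qed

lemma integrable_f: "integrable lborel f"
  by (rule integrableI_nonneg) (auto simp: f_nonneg nn_integral_f)

lemma integral_f: "integral\<^sup>L lborel f = 1"
  by (subst integral_eq_nn_integral) (auto simp: f_nonneg nn_integral_f)

text \<open>The support determines \<open>f\<close> only up to a null set, so passing from a
  half-line or the whole line to the type space is an almost-everywhere argument.\<close>

lemma AE_f_outside: "AE v in lborel. v \<notin> {0..vbar} \<longrightarrow> f v = 0"
proof -
  have "AE v in density lborel (\<lambda>v. ennreal (f v)). v \<in> {0..vbar}"
    using AE_in_measure_support[of "density lborel (\<lambda>v. ennreal (f v))"] density
    by (simp add: density_with_support_def)
  then have "AE v in lborel. 0 < ennreal (f v) \<longrightarrow> v \<in> {0..vbar}"
    by (subst (asm) AE_density) auto
  then show ?thesis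
    by eventually_elim (use f_nonneg in \<open>auto simp: ennreal_zero_less_mult_iff less_le\<close>)
qed

lemma LINT_from: "(LINT v:{q..}|lborel. h v * f v) = (LINT v:{q..vbar}|lborel. h v * f v)"
  if [measurable]: "h \<in> borel_measurable borel" for h :: "real \<Rightarrow> real"
  unfolding set_lebesgue_integral_def
  by (rule integral_cong_AE; (measurable)?) (use AE_f_outside in \<open>eventually_elim, auto simp: indicator_def\<close>)

lemma expect_1: "expect f vbar (\<lambda>_. 1) = 1"
proof -
  have "expect f vbar (\<lambda>_. 1) = integral\<^sup>L lborel f"
    unfolding expect_def set_lebesgue_integral_def
    by (rule integral_cong_AE; (measurable)?) (use AE_f_outside in \<open>eventually_elim, auto simp: indicator_def\<close>)
  then show ?thesis by (simp add: integral_f)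
qed

lemma set_integrable_bounded:
  fixes h :: "real \<Rightarrow> real"
  assumes h: "set_borel_measurable borel {0..vbar} h" and B: "\<And>v. v \<in> {0..vbar} \<Longrightarrow> \<bar>h v\<bar> \<le> B"
  shows "set_integrable lborel {0..vbar} (\<lambda>v. h v * f v)"
  unfolding set_integrable_def
proof (rule Bochner_Integration.integrable_bound[of _ "\<lambda>v. B * f v"])
  have [measurable]: "(\<lambda>v. indicator {0..vbar} v * h v) \<in> borel_measurable borel"
    using h by (simp add: set_borel_measurable_def)
  have "(\<lambda>v. (indicator {0..vbar} v * h v) * f v) \<in> borel_measurable borel" by measurable
  then show "(\<lambda>v. indicat_real {0..vbar} v *\<^sub>R (h v * f v)) \<in> borel_measurable lborel"
    by (simp add: ac_simps)
  show "AE v in lborel. norm (indicat_real {0..vbar} v *\<^sub>R (h v * f v)) \<le> norm (B * f v)"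
  proof (rule AE_I2)
    fix v
    show "norm (indicat_real {0..vbar} v *\<^sub>R (h v * f v)) \<le> norm (B * f v)"
      using B[of v] f_nonneg[of v] by (auto simp: indicator_def abs_mult intro!: mult_right_mono)
  qed
qed (simp add: integrable_f)

text \<open>The probability that the type is at least \<open>q\<close>; on the type space it is
  minus the derivative of \<open>price_utility f\<close>.\<close>

definition tail :: "real \<Rightarrow> real" where
  "tail q = (LINT v:{q..vbar}|lborel. f v)"

lemma set_integrable_f: "set_integrable lborel {a..b} f"
  unfolding set_integrable_def using integrable_f by (rule integrable_mult_indicator[rotated]) auto

lemma set_integrable_vf: "0 \<le> q \<Longrightarrow> set_integrable lborel {q..vbar} (\<lambda>v. v * f v)"
  by (rule set_integrable_subset[OF set_integrable_bounded[of "\<lambda>v. v" vbar]])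
    (auto simp: set_borel_measurable_def)

lemma tail_eq: "tail q = integral {q..vbar} f"
  unfolding tail_def by (rule set_borel_integral_eq_integral(2)[OF set_integrable_f])

lemma price_surplus_eq: "price_surplus f q = (LINT v:{q..vbar}|lborel. v * f v)"
  unfolding price_surplus_def by (rule LINT_from) simp

lemma price_utility_eq: "price_utility f q = (LINT v:{q..vbar}|lborel. (v - q) * f v)"
  unfolding price_utility_def by (rule LINT_from) simp

lemma price_utility_tail: "0 \<le> q \<Longrightarrow> price_utility f q = price_surplus f q - q * tail q"
  unfolding price_utility_eq price_surplus_eq tail_def
  using set_integrable_vf[of q] set_integrable_f[of q vbar]
  by (simp add: left_diff_distrib set_integral_diff)

text \<open>Extending the integrand by 0 below \<open>q\<close> puts all prices over the same
  interval, where expectations can be compared and combined.\<close>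

lemma price_utility_expect:
  assumes "0 \<le> q" "q \<le> vbar"
  shows "price_utility f q = expect f vbar (\<lambda>v. max 0 (v - q))"
  unfolding price_utility_eq expect_def set_lebesgue_integral_def
  by (rule Bochner_Integration.integral_cong) (use assms in \<open>auto simp: indicator_def max_def\<close>)

lemma continuous_on_tail: "continuous_on {0..vbar} tail"
  unfolding tail_eq[abs_def]
  by (rule indefinite_integral_continuous_1') (rule set_borel_integral_eq_integral(1)[OF set_integrable_f])

lemma continuous_on_price_surplus: "continuous_on {0..vbar} (price_surplus f)"
proof -
  have "continuous_on {0..vbar} (\<lambda>q. integral {q..vbar} (\<lambda>v. v * f v))"
    by (rule indefinite_integral_continuous_1', rule set_borel_integral_eq_integral(1), rule set_integrable_vf) simp
  then show ?thesis
    by (rule continuous_on_eq) (simp add: price_surplus_eq set_borel_integral_eq_integral(2)[OF set_integrable_vf])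
qed

lemma continuous_on_price_utility: "continuous_on {0..vbar} (price_utility f)"
proof -
  have "continuous_on {0..vbar} (\<lambda>q. price_surplus f q - q * tail q)"
    by (intro continuous_intros continuous_on_price_surplus continuous_on_tail)
  then show ?thesis by (rule continuous_on_eq) (simp add: price_utility_tail)
qed

lemma set_integrable_tail: "0 \<le> q \<Longrightarrow> set_integrable lborel {q..vbar} tail"
  by (rule borel_integrable_atLeastAtMost') (rule continuous_on_subset[OF continuous_on_tail], auto)

text \<open>The payoff \<open>max 0 (v - q)\<close> is the primitive from 0 of the indicator of
  \<open>{q..}\<close>, so exchanging the integrals leaves \<open>tail\<close> integrated over
  \<open>{q..vbar}\<close>.\<close>

lemma LINT_tail:
  assumes "q \<in> {0..vbar}"
  shows "(LINT z:{q..vbar}|lborel. tail z) = price_utility f q"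
proof -
  have i: "(LINT z:{0..v}|lborel. indicator {q..} z :: real) = max 0 (v - q)" if "v \<ge> 0" for v
  proof -
    have "(LINT z:{0..v}|lborel. indicator {q..} z :: real) = (LINT z|lborel. indicator {q..v} z)"
      unfolding set_lebesgue_integral_def
      by (rule Bochner_Integration.integral_cong) (use assms in \<open>auto simp: indicator_def\<close>)
    then show ?thesis by (simp add: max_def)
  qed
  have "price_utility f q = (LINT v:{0..vbar}|lborel. (LINT z:{0..v}|lborel. indicator {q..} z) * f v)"
    unfolding price_utility_expect[of q, OF assms[simplified, THEN conjunct1] assms[simplified, THEN conjunct2]] expect_def
    by (rule set_lebesgue_integral_cong) (auto simp: i)
  also have "\<dots> = (LINT z:{0..vbar}|lborel. indicator {q..} z * tail z)"
    unfolding tail_def by (rule integral_primitive_times_density(1)[OF integrable_f, of _ _ 1]) auto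
  also have "\<dots> = (LINT z:{q..vbar}|lborel. tail z)"
    unfolding set_lebesgue_integral_def
    by (rule Bochner_Integration.integral_cong) (use assms in \<open>auto simp: indicator_def\<close>)
  finally show ?thesis ..
qed

text \<open>Both expectations are integrals of \<open>y\<close> against one fixed weight, so the second mean value theorem
  replaces \<open>y\<close> by the indicator of an interval up to \<open>vbar\<close>, that is, by a posted price.\<close>

lemma monotone_allocation_posted_price:
  fixes y :: "real \<Rightarrow> real"
  assumes y: "mono y" "y 0 = 0" "y vbar = 1"
  obtains q where "q \<in> {0..vbar}"
    "expect f vbar (\<lambda>v. v * y v) - lam * expect f vbar (\<lambda>v. LINT z:{0..v}|lborel. y z)
      = price_surplus f q - lam * price_utility f q"
proof -
  have ym [measurable]: "y \<in> borel_measurable borel" using y(1) by (rule borel_measurable_mono)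
  have y01: "\<bar>y z\<bar> \<le> 1" if "z \<in> {0..vbar}" for z
    using monoD[OF y(1), of 0 z] monoD[OF y(1), of z vbar] that y(2,3) by auto
  \<comment> \<open>The term \<open>z * f z\<close> comes from the surplus, and
    \<open>lam * tail z\<close> from the utility after the exchange of integrals.\<close>
  define phi where "phi z = z * f z - lam * tail z" for z
  have phi_int: "set_integrable lborel {q..vbar} phi" if "0 \<le> q" for q
    unfolding phi_def using that
    by (intro set_integral_diff set_integrable_vf set_integrable_mult_right set_integrable_tail)
  \<comment> \<open>Over an upper interval the weight integrates to the Lagrangian of posting its
    lower end as the price.\<close>
  have phi_q: "integral {q..vbar} phi = price_surplus f q - lam * price_utility f q" if "q \<in> {0..vbar}" for q
  proof -
    have "integral {q..vbar} phi = (LINT z:{q..vbar}|lborel. phi z)"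
      by (rule set_borel_integral_eq_integral(2)[OF phi_int, symmetric]) (use that in auto)
    also have "\<dots> = price_surplus f q - lam * price_utility f q"
      unfolding phi_def price_surplus_eq LINT_tail[OF that, symmetric] using that
      by (simp add: set_integral_diff set_integrable_vf set_integrable_tail)
    finally show ?thesis .
  qed
  have i1: "set_integrable lborel {0..vbar} (\<lambda>v. v * y v * f v)"
  proof (rule set_integrable_bounded[of _ vbar])
    show "set_borel_measurable borel {0..vbar} (\<lambda>v. v * y v)" unfolding set_borel_measurable_def by measurable
    show "\<bar>v * y v\<bar> \<le> vbar" if "v \<in> {0..vbar}" for v
      using mult_mono[of "\<bar>v\<bar>" vbar "\<bar>y v\<bar>" 1] y01[OF that] that by (auto simp: abs_mult)
  qed
  have i2: "set_integrable lborel {0..vbar} (\<lambda>z. y z * tail z)"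
    unfolding set_integrable_def
  proof (rule Bochner_Integration.integrable_bound)
    show "integrable lborel (\<lambda>z. indicator {0..vbar} z *\<^sub>R tail z)"
      using set_integrable_tail[of 0] by (simp add: set_integrable_def)
    then have [measurable]: "(\<lambda>z. indicator {0..vbar} z * tail z) \<in> borel_measurable borel" by auto
    have "(\<lambda>z. y z * (indicator {0..vbar} z * tail z)) \<in> borel_measurable borel" by measurable
    then show "(\<lambda>z. indicator {0..vbar} z *\<^sub>R (y z * tail z)) \<in> borel_measurable lborel"
      by (simp add: ac_simps)
    show "AE z in lborel. norm (indicator {0..vbar} z *\<^sub>R (y z * tail z)) \<le> norm (indicator {0..vbar} z *\<^sub>R tail z)"
    proof (rule AE_I2)
      fix z
      show "norm (indicator {0..vbar} z *\<^sub>R (y z * tail z)) \<le> norm (indicator {0..vbar} z *\<^sub>R tail z)"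
        using mult_right_mono[OF y01[of z], of "\<bar>tail z\<bar>"] by (auto simp: indicator_def abs_mult)
    qed
  qed
  have e: "y z * phi z = z * y z * f z - lam * (y z * tail z)" for z
    by (simp add: phi_def algebra_simps)
  have yphi: "set_integrable lborel {0..vbar} (\<lambda>z. y z * phi z)"
    unfolding e using i1 i2 by (intro set_integral_diff set_integrable_mult_right)
  have "expect f vbar (\<lambda>v. LINT z:{0..v}|lborel. y z) = (LINT z:{0..vbar}|lborel. y z * tail z)"
    unfolding expect_def tail_def
    by (rule integral_primitive_times_density(1)[OF integrable_f ym y01])
  then have eq: "expect f vbar (\<lambda>v. v * y v) - lam * expect f vbar (\<lambda>v. LINT z:{0..v}|lborel. y z)
      = (LINT z:{0..vbar}|lborel. y z * phi z)"
    unfolding e expect_def using i1 i2 by (simp add: set_integral_diff)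
  \<comment> \<open>The end values 0 and 1 of \<open>y\<close> delete the lower interval and keep
    the upper one with coefficient 1.\<close>
  obtain q where q: "q \<in> {0..vbar}"
    "integral {0..vbar} (\<lambda>z. y z * phi z) = y 0 * integral {0..q} phi + y vbar * integral {q..vbar} phi"
  proof (rule second_mean_value_theorem[of phi 0 vbar y])
    show "phi integrable_on {0..vbar}" using set_borel_integral_eq_integral(1)[OF phi_int[of 0]] by simp
  qed (use vbar_pos monoD[OF y(1)] in auto)
  have "(LINT z:{0..vbar}|lborel. y z * phi z) = price_surplus f q - lam * price_utility f q"
    unfolding set_borel_integral_eq_integral(2)[OF yphi] q(2) phi_q[OF q(1)] using y by simp
  then show thesis using that[OF q(1)] eq by simp
qed

end

section \<open>Supporting lines for mixtures of two prices\<close>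

text \<open>In the plane of points \<open>(u q, S q)\<close>, the best mixture with first coordinate
  \<open>c\<close> lies on the upper boundary of the convex hull of the curve, and
  \<open>lam\<close> is the slope of a supporting line there. The strict bounds on \<open>c\<close>
  keep the slope finite; that \<open>S\<close> is largest at 0, where \<open>u\<close> is also
  largest, makes it nonnegative.\<close>

lemma two_point_multiplier:
  fixes u S :: "real \<Rightarrow> real"
  assumes contu: "continuous_on {0..b} u" and contS: "continuous_on {0..b} S" and b: "0 \<le> b"
    and anti: "antimono_on {0..b} u" and S0: "\<And>q. q \<in> {0..b} \<Longrightarrow> S q \<le> S 0"
    and c: "u b < c" "c < u 0"
  obtains p1 p2 \<alpha> lam where "p1 \<in> {0..b}" "p2 \<in> {0..b}" "p1 \<le> p2" "\<alpha> \<in> {0..1}" "0 \<le> lam"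
    "\<alpha> * u p1 + (1 - \<alpha>) * u p2 = c"
    "\<And>q. q \<in> {0..b} \<Longrightarrow> S q - lam * u q \<le> (\<alpha> * S p1 + (1 - \<alpha>) * S p2) - lam * c"
proof -
  \<comment> \<open>A triple consists of the weight of the lower price, the lower price and the
    upper price; \<open>K\<close> keeps those with utility exactly \<open>c\<close>.\<close>
  define D where "D = ({0..1} \<times> {0..b} \<times> {0..b}) \<inter> {w :: real \<times> real \<times> real. fst (snd w) \<le> snd (snd w)}"
  define mix where "mix h w = fst w * h (fst (snd w)) + (1 - fst w) * h (snd (snd w))"
    for h :: "real \<Rightarrow> real" and w :: "real \<times> real \<times> real"
  define K where "K = {w \<in> D. mix u w = c}"
  have cl: "closed {w :: real \<times> real \<times> real. fst (snd w) \<le> snd (snd w)}"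
    by (intro closed_Collect_le continuous_intros)
  have "compact D" unfolding D_def by (intro compact_Int_closed compact_Times cl) auto
  have contmix: "continuous_on D (mix h)" if "continuous_on {0..b} h" for h
    unfolding mix_def
    by (intro continuous_intros continuous_on_compose2[OF that]) (auto simp: D_def)
  have "closed K" unfolding K_def
    by (intro continuous_closed_preimage_constant contmix contu compact_imp_closed \<open>compact D\<close>)
  then have "compact K"
    using compact_Int_closed[OF \<open>compact D\<close>, of K] by (simp add: K_def Int_absorb1 subset_eq Int_def)
  \<comment> \<open>The weight solves \<open>\<alpha> * u q + (1 - \<alpha>) * u r = c\<close>. As
    \<open>u\<close> is antitone, the price with the larger utility is the lower one.\<close>
  have chord: "((c - u r) / (u q - u r), q, r) \<in> K"
    if "q \<in> {0..b}" "r \<in> {0..b}" "u r < c" "c < u q" for q r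
  proof -
    have "q \<le> r" using monotone_onD[OF anti, of r q] that by fastforce
    then show ?thesis using that by (auto simp: K_def D_def mix_def field_simps)
  qed
  have "K \<noteq> {}" using chord[of 0 b] b c by auto
  then obtain w where w: "w \<in> K" and max: "\<And>w'. w' \<in> K \<Longrightarrow> mix S w' \<le> mix S w"
    using continuous_attains_sup[OF \<open>compact K\<close> _ continuous_on_subset[OF contmix[OF contS]]]
    by (metis (no_types, lifting) K_def mem_Collect_eq subsetI)
  obtain \<alpha> p1 p2 where weq: "w = (\<alpha>, p1, p2)" by (cases w) auto
  define V where "V = mix S w"
  have Vle: "V \<le> S 0"
  proof -
    have "\<alpha> * S p1 + (1 - \<alpha>) * S p2 \<le> \<alpha> * S 0 + (1 - \<alpha>) * S 0"
      using w by (intro add_mono mult_left_mono S0) (auto simp: weq K_def D_def)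
    then show ?thesis by (simp add: V_def mix_def weq algebra_simps)
  qed
  \<comment> \<open>If the slope to the right of \<open>c\<close> were larger than the one to the
    left, the chord joining the two points would pass above the maximum \<open>V\<close> at
    \<open>c\<close>.\<close>
  have slope: "(S q - V) / (u q - c) \<le> (V - S r) / (c - u r)"
    if "q \<in> {0..b}" "r \<in> {0..b}" "u r < c" "c < u q" for q r
  proof -
    have "mix S ((c - u r) / (u q - u r), q, r) \<le> V"
      unfolding V_def using chord that max by blast
    moreover have "1 - (c - u r) / (u q - u r) = (u q - c) / (u q - u r)"
      using that by (simp add: field_simps)
    then have "mix S ((c - u r) / (u q - u r), q, r) = ((c - u r) * S q + (u q - c) * S r) / (u q - u r)"
      by (simp add: mix_def add_divide_distrib)
    ultimately have "(c - u r) * S q + (u q - c) * S r \<le> V * (u q - u r)"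
      using that by (simp add: pos_divide_le_eq)
    then show ?thesis using that by (simp add: divide_simps algebra_simps)
  qed
  \<comment> \<open>The slopes to the right of \<open>c\<close>. Their supremum \<open>lam\<close>
    lies below every slope to the left; the prices 0 and \<open>b\<close> supply one slope on each
    side.\<close>
  define A where "A = (\<lambda>q. (S q - V) / (u q - c)) ` {q \<in> {0..b}. c < u q}"
  have bdd: "bdd_above A"
    unfolding A_def by (intro bdd_aboveI2[where M = "(V - S b) / (c - u b)"] slope) (use b c in auto)
  have A0: "(S 0 - V) / (u 0 - c) \<in> A" using b c by (auto simp: A_def)
  define lam where "lam = Sup A"
  have lam_ge: "a \<le> lam" if "a \<in> A" for a
    unfolding lam_def using that bdd by (rule cSup_upper)
  have lam_le: "lam \<le> (V - S r) / (c - u r)" if "r \<in> {0..b}" "u r < c" for r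
    unfolding lam_def using A0 that by (intro cSup_least) (auto simp: A_def intro!: slope)
  have "0 \<le> (S 0 - V) / (u 0 - c)" using Vle c by simp
  with lam_ge[OF A0] have lam0: "0 \<le> lam" by linarith
  have bound: "S q - lam * u q \<le> V - lam * c" if q: "q \<in> {0..b}" for q
  proof (cases "u q" c rule: linorder_cases)
    case less
    with lam_le[OF q less] show ?thesis by (simp add: pos_le_divide_eq algebra_simps)
  next
    case equal
    \<comment> \<open>A single price with utility \<open>c\<close> is a degenerate mixture and so
      competes in the maximum.\<close>
    have "(1, q, q) \<in> K" using q equal by (auto simp: K_def D_def mix_def)
    from max[OF this] equal show ?thesis by (simp add: V_def mix_def)
  next
    case greater
    have "(S q - V) / (u q - c) \<le> lam" using q greater by (intro lam_ge) (auto simp: A_def)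
    with greater show ?thesis by (simp add: pos_divide_le_eq algebra_simps)
  qed
  show thesis
    by (rule that[of p1 p2 \<alpha> lam])
      (use w lam0 bound in \<open>auto simp: weq K_def D_def mix_def V_def\<close>)
qed

section \<open>Incentive compatible mechanisms\<close>

text \<open>The utility bound is split off from \<open>feasible\<close> so that mechanisms for
  different bounds can be mixed and compared.\<close>

definition mechanism :: "real \<Rightarrow> (real \<Rightarrow> real) \<Rightarrow> (real \<Rightarrow> real) \<Rightarrow> bool" where
  "mechanism vbar x p \<longleftrightarrow> (\<forall>v\<in>{0..vbar}. 0 \<le> x v \<and> x v \<le> 1) \<and>
     incentive_compatible vbar x p \<and> individually_rational vbar x p"

lemma feasible_iff: "feasible f vbar c x p \<longleftrightarrow> mechanism vbar x p \<and> exp_utility f vbar x p \<le> c"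
  by (auto simp: feasible_def mechanism_def)

lemma mechanism_alloc: "mechanism vbar x p \<Longrightarrow> v \<in> {0..vbar} \<Longrightarrow> 0 \<le> x v \<and> x v \<le> 1"
  by (auto simp: mechanism_def)

lemma mechanism_utility_nonneg: "mechanism vbar x p \<Longrightarrow> v \<in> {0..vbar} \<Longrightarrow> 0 \<le> v * x v - p v"
  by (auto simp: mechanism_def individually_rational_def)

text \<open>Reporting \<open>w\<close> gives type \<open>v\<close> the utility of type
  \<open>w\<close> plus \<open>x w * (v - w)\<close>, so incentive compatibility is the subgradient
  inequality for the indirect utility.\<close>

lemma mechanism_subgradient:
  assumes "mechanism vbar x p" "v \<in> {0..vbar}" "w \<in> {0..vbar}"
  shows "(w * x w - p w) + x w * (v - w) \<le> v * x v - p v"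
  using assms by (auto simp: mechanism_def incentive_compatible_def algebra_simps)

lemma mechanism_mono_on:
  assumes m: "mechanism vbar x p"
  shows "mono_on {0..vbar} x"
proof (rule mono_onI)
  fix r s assume rs: "r \<in> {0..vbar}" "s \<in> {0..vbar}" "r \<le> s"
  \<comment> \<open>The two subgradient inequalities between \<open>r\<close> and \<open>s\<close>
    are added.\<close>
  have "x r * (s - r) \<le> x s * (s - r)"
    using mechanism_subgradient[OF m, of r s] mechanism_subgradient[OF m, of s r] rs
    by (simp add: algebra_simps)
  then show "x r \<le> x s" using rs by (cases "r = s") auto
qed

text \<open>All the subgradients \<open>x w\<close> lie between 0 and 1. The bound provides
  continuity, hence measurability, and boundedness of the indirect utility.\<close>

lemma mechanism_utility_lipschitz:
  assumes m: "mechanism vbar x p" and "v \<in> {0..vbar}" "w \<in> {0..vbar}"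
  shows "\<bar>(v * x v - p v) - (w * x w - p w)\<bar> \<le> \<bar>v - w\<bar>"
proof -
  have *: "\<bar>x t * (v - w)\<bar> \<le> \<bar>v - w\<bar>" if "t \<in> {0..vbar}" for t
    using mechanism_alloc[OF m that] mult_right_mono[of "\<bar>x t\<bar>" 1 "\<bar>v - w\<bar>"] by (simp add: abs_mult)
  show ?thesis
    using mechanism_subgradient[OF m, of v w] mechanism_subgradient[OF m, of w v] *[of v] *[of w] assms(2,3)
    by (auto simp: algebra_simps abs_le_iff)
qed

lemma mechanism_measurable:
  assumes m: "mechanism vbar x p"
  shows "set_borel_measurable borel {0..vbar} x"
    and "set_borel_measurable borel {0..vbar} (\<lambda>v. v * x v - p v)"
proof -
  have "x \<in> borel_measurable (restrict_space borel {0..vbar})"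
    by (rule borel_measurable_mono_on_fnc[OF mechanism_mono_on[OF m]])
  then show "set_borel_measurable borel {0..vbar} x"
    by (simp add: set_borel_measurable_def borel_measurable_restrict_space_iff)
  have "continuous_on {0..vbar} (\<lambda>v. v * x v - p v)"
    unfolding continuous_on_iff dist_real_def
    using mechanism_utility_lipschitz[OF m] by (meson le_less_trans)
  then show "set_borel_measurable borel {0..vbar} (\<lambda>v. v * x v - p v)"
    unfolding set_borel_measurable_def by (rule borel_measurable_continuous_on_indicator[rotated]) simp
qed

lemma posted_utility: "v * posted_alloc q v - posted_payment q v = max 0 (v - q)"
  by (auto simp: posted_alloc_def posted_payment_def)

text \<open>A report only selects between the payoffs 0 and \<open>v - q\<close>; this is incentive
  compatibility of a posted price.\<close>

lemma posted_utility_le: "v * posted_alloc q w - posted_payment q w \<le> max 0 (v - q)"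
  by (auto simp: posted_alloc_def posted_payment_def)

text \<open>For each fixed true type and report the constraints are linear in \<open>x\<close> and
  \<open>p\<close>. This serves both randomized prices and concavity of the optimal value.\<close>

lemma mechanism_mixture:
  assumes m: "mechanism vbar x p" "mechanism vbar x' p'" and t: "t \<in> {0..1}"
  shows "mechanism vbar (\<lambda>v. t * x v + (1 - t) * x' v) (\<lambda>v. t * p v + (1 - t) * p' v)"
proof -
  have split: "v * (t * x w + (1 - t) * x' w) - (t * p w + (1 - t) * p' w)
      = t * (v * x w - p w) + (1 - t) * (v * x' w - p' w)" for v w
    by (simp add: algebra_simps)
  show ?thesis
    unfolding mechanism_def incentive_compatible_def individually_rational_def split
  proof (intro conjI ballI)
    fix v w assume v: "v \<in> {0..vbar}" "w \<in> {0..vbar}"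
    show "t * (v * x w - p w) + (1 - t) * (v * x' w - p' w) \<le> t * (v * x v - p v) + (1 - t) * (v * x' v - p' v)"
      using m v t by (intro add_mono mult_left_mono) (auto simp: mechanism_def incentive_compatible_def)
  next
    fix v assume v: "v \<in> {0..vbar}"
    show "0 \<le> t * (v * x v - p v) + (1 - t) * (v * x' v - p' v)"
      using mechanism_utility_nonneg[OF m(1) v] mechanism_utility_nonneg[OF m(2) v] t by simp
    show "0 \<le> t * x v + (1 - t) * x' v"
      using mechanism_alloc[OF m(1) v] mechanism_alloc[OF m(2) v] t by simp
    show "t * x v + (1 - t) * x' v \<le> 1"
      using mechanism_alloc[OF m(1) v] mechanism_alloc[OF m(2) v] t
      by (intro convex_bound_le) auto
  qed
qed

lemma borel_measurable_posted_alloc [measurable]: "posted_alloc q \<in> borel_measurable borel"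
  by (rule borel_measurable_mono) (auto simp: mono_def posted_alloc_def)

lemma mechanism_posted: "mechanism vbar (posted_alloc q) (posted_payment q)"
  unfolding mechanism_def incentive_compatible_def individually_rational_def posted_utility
  using posted_utility_le by (auto simp: posted_alloc_def)

section \<open>Expected surplus and utility, and the bound by a multiplier\<close>

context value_density begin

lemma mechanism_set_integrable:
  assumes m: "mechanism vbar x p"
  shows "set_integrable lborel {0..vbar} (\<lambda>v. v * x v * f v)"
    and "set_integrable lborel {0..vbar} (\<lambda>v. (v * x v - p v) * f v)"
proof -
  have [measurable]: "(\<lambda>v. indicator {0..vbar} v * x v) \<in> borel_measurable borel"
    using mechanism_measurable(1)[OF m] by (simp add: set_borel_measurable_def)
  have "(\<lambda>v. v * (indicator {0..vbar} v * x v)) \<in> borel_measurable borel" by measurable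
  then have "set_borel_measurable borel {0..vbar} (\<lambda>v. v * x v)"
    by (simp add: set_borel_measurable_def ac_simps)
  moreover have "\<bar>v * x v\<bar> \<le> vbar" if "v \<in> {0..vbar}" for v
    using mult_mono[of "\<bar>v\<bar>" vbar "\<bar>x v\<bar>" 1] mechanism_alloc[OF m that] that by (auto simp: abs_mult)
  ultimately show "set_integrable lborel {0..vbar} (\<lambda>v. v * x v * f v)"
    by (rule set_integrable_bounded)
  \<comment> \<open>Type 0 has utility \<open>- p 0\<close>, and the Lipschitz bound adds at most
    \<open>vbar\<close>.\<close>
  have "\<bar>v * x v - p v\<bar> \<le> \<bar>p 0\<bar> + vbar" if "v \<in> {0..vbar}" for v
    using mechanism_utility_lipschitz[OF m that, of 0] that vbar_pos by auto
  with mechanism_measurable(2)[OF m]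
  show "set_integrable lborel {0..vbar} (\<lambda>v. (v * x v - p v) * f v)"
    by (rule set_integrable_bounded)
qed

lemma expect_mono:
  assumes "set_integrable lborel {0..vbar} (\<lambda>v. g v * f v)" "set_integrable lborel {0..vbar} (\<lambda>v. h v * f v)"
    and "\<And>v. v \<in> {0..vbar} \<Longrightarrow> g v \<le> h v"
  shows "expect f vbar g \<le> expect f vbar h"
  unfolding expect_def using assms f_nonneg by (intro set_integral_mono) (auto intro: mult_right_mono)

lemma expect_cong: "(\<And>v. v \<in> {0..vbar} \<Longrightarrow> g v = h v) \<Longrightarrow> expect f vbar g = expect f vbar h"
  unfolding expect_def by (rule set_lebesgue_integral_cong) auto

lemma expect_linear:
  assumes "set_integrable lborel {0..vbar} (\<lambda>v. g v * f v)" "set_integrable lborel {0..vbar} (\<lambda>v. h v * f v)"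
  shows "expect f vbar (\<lambda>v. s * g v + t * h v) = s * expect f vbar g + t * expect f vbar h"
proof -
  have "(\<lambda>v. (s * g v + t * h v) * f v) = (\<lambda>v. s * (g v * f v) + t * (h v * f v))"
    by (simp add: fun_eq_iff algebra_simps)
  then show ?thesis unfolding expect_def using assms by (simp add: set_integral_add)
qed

lemma exp_surplus_mixture:
  assumes m: "mechanism vbar x p" "mechanism vbar x' p'"
  shows "exp_surplus f vbar (\<lambda>v. t * x v + (1 - t) * x' v)
    = t * exp_surplus f vbar x + (1 - t) * exp_surplus f vbar x'"
  unfolding exp_surplus_def
  by (subst expect_linear[OF mechanism_set_integrable(1)[OF m(1)] mechanism_set_integrable(1)[OF m(2)], symmetric])
    (simp add: algebra_simps)

lemma exp_utility_mixture:
  assumes m: "mechanism vbar x p" "mechanism vbar x' p'"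
  shows "exp_utility f vbar (\<lambda>v. t * x v + (1 - t) * x' v) (\<lambda>v. t * p v + (1 - t) * p' v)
    = t * exp_utility f vbar x p + (1 - t) * exp_utility f vbar x' p'"
  unfolding exp_utility_def
  by (subst expect_linear[OF mechanism_set_integrable(2)[OF m(1)] mechanism_set_integrable(2)[OF m(2)], symmetric])
    (simp add: algebra_simps)

text \<open>The type \<open>q\<close> itself does not buy but is counted in
  \<open>price_surplus\<close>; a single point is a null set.\<close>

lemma exp_surplus_posted: "q \<in> {0..vbar} \<Longrightarrow> exp_surplus f vbar (posted_alloc q) = price_surplus f q"
  unfolding exp_surplus_def expect_def price_surplus_eq set_lebesgue_integral_def
  by (rule integral_cong_AE; (measurable)?)
    (use AE_lborel_singleton[of q] in \<open>eventually_elim, auto simp: indicator_def posted_alloc_def\<close>)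

lemma exp_utility_posted:
  "q \<in> {0..vbar} \<Longrightarrow> exp_utility f vbar (posted_alloc q) (posted_payment q) = price_utility f q"
  unfolding exp_utility_def posted_utility by (simp add: price_utility_expect)

text \<open>Weak duality. The utility is at least the primitive of \<open>x\<close>, so with
  \<open>lam \<ge> 0\<close> replacing it by that primitive can only raise the Lagrangian, which
  then equals that of some posted price.\<close>

lemma exp_surplus_le_multiplier:
  assumes m: "mechanism vbar x p" and "0 \<le> lam"
    and price: "\<And>q. q \<in> {0..vbar} \<Longrightarrow> price_surplus f q - lam * price_utility f q \<le> a"
  shows "exp_surplus f vbar x \<le> a + lam * exp_utility f vbar x p"
proof -
  \<comment> \<open>The second mean value argument wants a monotone function on the line with end
    values 0 and 1. Bounds on \<open>x\<close> keep \<open>y\<close> monotone, and within the type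
    space only the points 0 and \<open>vbar\<close> change.\<close>
  define y where "y z = (if z \<le> 0 then 0 else if vbar \<le> z then 1 else x z)" for z
  have y: "mono y" "y 0 = 0" "y vbar = 1"
    using vbar_pos mechanism_alloc[OF m] mono_onD[OF mechanism_mono_on[OF m]]
    by (auto simp: y_def mono_def)
  have ym [measurable]: "y \<in> borel_measurable borel" using y(1) by (rule borel_measurable_mono)
  have y01: "\<bar>y z\<bar> \<le> 1" for z
    using mechanism_alloc[OF m, of z] by (auto simp: y_def)
  obtain q where q: "q \<in> {0..vbar}"
    "expect f vbar (\<lambda>v. v * y v) - lam * expect f vbar (\<lambda>v. LINT z:{0..v}|lborel. y z)
      = price_surplus f q - lam * price_utility f q"
    using monotone_allocation_posted_price[OF y] .
  have "exp_surplus f vbar x = expect f vbar (\<lambda>v. v * y v)"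
    unfolding exp_surplus_def expect_def set_lebesgue_integral_def
  proof (rule integral_cong_AE)
    show "(\<lambda>v. indicator {0..vbar} v *\<^sub>R (v * x v * f v)) \<in> borel_measurable lborel"
      using mechanism_set_integrable(1)[OF m] by (auto simp: set_integrable_def)
    show "AE v in lborel. indicator {0..vbar} v *\<^sub>R (v * x v * f v) = indicator {0..vbar} v *\<^sub>R (v * y v * f v)"
      using AE_lborel_singleton[of vbar] AE_lborel_singleton[of 0]
      by eventually_elim (auto simp: indicator_def y_def)
  qed measurable
  moreover have "expect f vbar (\<lambda>v. LINT z:{0..v}|lborel. y z) \<le> exp_utility f vbar x p"
    unfolding exp_utility_def
  proof (rule expect_mono)
    show "set_integrable lborel {0..vbar} (\<lambda>v. (LINT z:{0..v}|lborel. y z) * f v)"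
      by (rule integral_primitive_times_density(2)[OF integrable_f ym y01])
    show "set_integrable lborel {0..vbar} (\<lambda>v. (v * x v - p v) * f v)"
      by (rule mechanism_set_integrable(2)[OF m])
    fix v assume v: "v \<in> {0..vbar}"
    have "set_integrable lborel {0..v} y"
      unfolding set_integrable_def
      by (rule Bochner_Integration.integrable_bound[of _ "indicator {0..v} :: real \<Rightarrow> real"])
        (use y01 in \<open>auto simp: indicator_def intro!: integrable_real_indicator emeasure_bounded_finite\<close>)
    then have "(LINT z:{0..v}|lborel. y z) = integral {0..v} y"
      by (rule set_borel_integral_eq_integral(2))
    also have "\<dots> = integral {0..v} x"
      by (rule integral_spike[of "{0, vbar}"]) (use v in \<open>auto simp: y_def\<close>)
    \<comment> \<open>Individual rationality enters here, at type 0 only.\<close>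
    also have "\<dots> \<le> (0 * x 0 - p 0) + integral {0..v} x"
      using mechanism_utility_nonneg[OF m, of 0] vbar_pos by simp
    also have "\<dots> \<le> v * x v - p v"
      by (rule integral_subgradient_le)
        (use v mechanism_subgradient[OF m] mono_on_subset[OF mechanism_mono_on[OF m]] in auto)
    finally show "(LINT z:{0..v}|lborel. y z) \<le> v * x v - p v" .
  qed
  ultimately show ?thesis
    using q(2) price[OF q(1)] mult_left_mono[OF _ \<open>0 \<le> lam\<close>] by fastforce
qed

text \<open>The set \<open>{m<..}\<close> is an open neighbourhood of the support point
  \<open>vbar\<close>, so it has positive mass, and the part of it outside the type space has
  none.\<close>

lemma expect_above_pos:
  assumes "m < vbar"
  shows "0 < expect f vbar (indicator {m<..})"
proof -
  let ?h = "\<lambda>v. indicator {0..vbar} v *\<^sub>R (indicator {m<..} v * f v)"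
  have int: "integrable lborel ?h"
    using set_integrable_bounded[of "indicator {m<..}" 1] by (auto simp: set_integrable_def set_borel_measurable_def)
  have nonneg: "AE v in lborel. 0 \<le> ?h v" using f_nonneg by auto
  have "vbar \<in> measure_support (density lborel (\<lambda>v. ennreal (f v)))"
    using density vbar_pos by (simp add: density_with_support_def)
  then have "0 < emeasure (density lborel (\<lambda>v. ennreal (f v))) {m<..}"
    using assms by (auto simp: measure_support_def)
  then have pos: "0 < (\<integral>\<^sup>+ v. ennreal (f v) * indicator {m<..} v \<partial>lborel)" by (simp add: emeasure_density)
  have "expect f vbar (indicator {m<..}) \<noteq> 0"
  proof
    assume "expect f vbar (indicator {m<..}) = 0"
    then have "AE v in lborel. ?h v = 0"
      using integral_nonneg_eq_0_iff_AE[OF int nonneg] by (simp add: expect_def set_lebesgue_integral_def)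
    with AE_f_outside have "AE v in lborel. ennreal (f v) * indicator {m<..} v = 0"
      by eventually_elim (auto simp: indicator_def split: if_splits)
    then have "(\<integral>\<^sup>+ v. ennreal (f v) * indicator {m<..} v \<partial>lborel) = 0"
      by (subst nn_integral_0_iff_AE) auto
    with pos show False by simp
  qed
  moreover have "0 \<le> expect f vbar (indicator {m<..})"
    unfolding expect_def set_lebesgue_integral_def by (rule integral_nonneg_AE[OF nonneg])
  ultimately show ?thesis by simp
qed

lemma set_integrable_call:
  "set_integrable lborel {0..vbar} (\<lambda>v. max 0 (v - q) * f v)"
  by (rule set_integrable_bounded[of _ "\<bar>vbar\<bar> + \<bar>q\<bar>"]) (auto simp: set_borel_measurable_def)

lemma price_utility_strict_antimono:
  assumes "p \<in> {0..vbar}" "q \<in> {0..vbar}" "p < q"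
  shows "price_utility f q < price_utility f p"
proof -
  \<comment> \<open>The price \<open>q\<close> may be \<open>vbar\<close>, above which there is no
    mass. So the gain from the lower price, at least \<open>m - p\<close>, is measured on types
    above a point strictly between the prices.\<close>
  define m where "m = (p + q) / 2"
  have m: "p < m" "m < q" using assms by (auto simp: m_def)
  have "0 < (m - p) * expect f vbar (indicator {m<..})"
    using m assms by (intro mult_pos_pos expect_above_pos) auto
  have ii: "set_integrable lborel {0..vbar} (\<lambda>v. indicator {m<..} v * f v)"
    by (rule set_integrable_bounded[of _ 1]) (auto simp: set_borel_measurable_def)
  have "(m - p) * expect f vbar (indicator {m<..}) + 1 * expect f vbar (\<lambda>v. max 0 (v - q))
      = expect f vbar (\<lambda>v. (m - p) * indicator {m<..} v + 1 * max 0 (v - q))"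
    by (rule expect_linear[OF ii set_integrable_call, symmetric])
  also have "\<dots> \<le> expect f vbar (\<lambda>v. max 0 (v - p))"
  proof (rule expect_mono)
    show "set_integrable lborel {0..vbar} (\<lambda>v. ((m - p) * indicator {m<..} v + 1 * max 0 (v - q)) * f v)"
      by (rule set_integrable_bounded[of _ "\<bar>m - p\<bar> + \<bar>vbar\<bar> + \<bar>q\<bar>"])
        (auto simp: set_borel_measurable_def indicator_def)
    show "set_integrable lborel {0..vbar} (\<lambda>v. max 0 (v - p) * f v)" by (rule set_integrable_call)
  qed (use m m_def in \<open>auto simp: indicator_def max_def field_simps\<close>)
  finally show ?thesis
    using \<open>0 < (m - p) * _\<close> assms by (simp add: price_utility_expect)
qed

lemma price_surplus_0: "price_surplus f 0 = expect f vbar (\<lambda>v. v)"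
  by (simp add: price_surplus_eq expect_def)

lemma price_utility_0: "price_utility f 0 = expect f vbar (\<lambda>v. v)"
  by (simp add: price_utility_eq expect_def)

lemma price_vbar: "price_surplus f vbar = 0" "price_utility f vbar = 0"
proof -
  show S: "price_surplus f vbar = 0"
    using set_borel_integral_eq_integral(2)[OF set_integrable_vf[of vbar]] vbar_pos
    unfolding price_surplus_eq by simp
  show "price_utility f vbar = 0"
    using price_utility_tail[of vbar] vbar_pos S by (simp add: tail_eq)
qed

lemma exp_surplus_le_expect: "mechanism vbar x p \<Longrightarrow> exp_surplus f vbar x \<le> expect f vbar (\<lambda>v. v)"
  unfolding exp_surplus_def
  by (rule expect_mono)
    (use mechanism_set_integrable(1) set_integrable_vf[of 0] mechanism_alloc in \<open>auto intro: mult_left_le\<close>)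

text \<open>The subgradient at \<open>q\<close> and individual rationality bound the utility of
  \<open>v\<close> below by \<open>x q * max 0 (v - q)\<close>. For \<open>q < vbar\<close> the
  hinge has positive expectation, so zero expected utility forces \<open>x q = 0\<close>.\<close>

lemma feasible_0_exp_surplus_le:
  assumes "feasible f vbar 0 x p"
  shows "exp_surplus f vbar x \<le> 0"
proof -
  have m: "mechanism vbar x p" and u0: "exp_utility f vbar x p \<le> 0"
    using assms by (auto simp: feasible_iff)
  have x0: "x q = 0" if q: "0 \<le> q" "q < vbar" for q
  proof -
    \<comment> \<open>The vanishing second term gives the integrand the shape of
      \<open>expect_linear\<close>.\<close>
    have "x q * price_utility f q = expect f vbar (\<lambda>v. x q * max 0 (v - q) + 0 * max 0 (v - q))"
      using q expect_linear[OF set_integrable_call set_integrable_call, of "x q" q 0 q] by (simp add: price_utility_expect)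
    also have "\<dots> \<le> exp_utility f vbar x p"
      unfolding exp_utility_def
    proof (rule expect_mono)
      have "set_integrable lborel {0..vbar} (\<lambda>v. x q * (max 0 (v - q) * f v))"
        by (rule set_integrable_mult_right) (rule set_integrable_call)
      then show "set_integrable lborel {0..vbar} (\<lambda>v. (x q * max 0 (v - q) + 0 * max 0 (v - q)) * f v)"
        by (simp add: ac_simps)
      show "set_integrable lborel {0..vbar} (\<lambda>v. (v * x v - p v) * f v)"
        by (rule mechanism_set_integrable(2)[OF m])
      fix v assume "v \<in> {0..vbar}"
      then show "x q * max 0 (v - q) + 0 * max 0 (v - q) \<le> v * x v - p v"
        using mechanism_subgradient[OF m, of v q] mechanism_utility_nonneg[OF m, of v]
          mechanism_utility_nonneg[OF m, of q] q by (auto simp: max_def)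
    qed
    finally have "x q * price_utility f q \<le> 0" using u0 by simp
    moreover have "0 < price_utility f q"
      using price_utility_strict_antimono[of q vbar] price_vbar q by simp
    ultimately show ?thesis
      using mechanism_alloc[OF m, of q] q by (auto simp: mult_le_0_iff)
  qed
  have "exp_surplus f vbar x = (LINT (v::real)|lborel. 0)"
    unfolding exp_surplus_def expect_def set_lebesgue_integral_def
  proof (rule integral_cong_AE)
    show "(\<lambda>v. indicator {0..vbar} v *\<^sub>R (v * x v * f v)) \<in> borel_measurable lborel"
      using mechanism_set_integrable(1)[OF m] by (auto simp: set_integrable_def)
    show "AE v in lborel. indicator {0..vbar} v *\<^sub>R (v * x v * f v) = 0"
      using AE_lborel_singleton[of vbar] by eventually_elim (auto simp: indicator_def x0)
  qed simp
  then show ?thesis by simp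
qed

lemma mechanism_two_price:
  assumes "p1 \<in> {0..vbar}" "p2 \<in> {0..vbar}" "p1 \<le> p2" "\<alpha> \<in> {0..1}"
  shows "mechanism vbar (two_price_alloc \<alpha> p1 p2) (two_price_payment \<alpha> p1 p2)"
    and "exp_utility f vbar (two_price_alloc \<alpha> p1 p2) (two_price_payment \<alpha> p1 p2)
      = \<alpha> * price_utility f p1 + (1 - \<alpha>) * price_utility f p2"
    and "exp_surplus f vbar (two_price_alloc \<alpha> p1 p2)
      = \<alpha> * price_surplus f p1 + (1 - \<alpha>) * price_surplus f p2"
proof -
  have eq: "two_price_alloc \<alpha> p1 p2 = (\<lambda>v. \<alpha> * posted_alloc p1 v + (1 - \<alpha>) * posted_alloc p2 v)"
    "two_price_payment \<alpha> p1 p2 = (\<lambda>v. \<alpha> * posted_payment p1 v + (1 - \<alpha>) * posted_payment p2 v)"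
    using assms two_price_alloc_randomization by (auto simp: fun_eq_iff two_price_payment_def)
  note m = mechanism_posted[of vbar p1] mechanism_posted[of vbar p2]
  show "mechanism vbar (two_price_alloc \<alpha> p1 p2) (two_price_payment \<alpha> p1 p2)"
    unfolding eq by (rule mechanism_mixture[OF m assms(4)])
  show "exp_utility f vbar (two_price_alloc \<alpha> p1 p2) (two_price_payment \<alpha> p1 p2)
      = \<alpha> * price_utility f p1 + (1 - \<alpha>) * price_utility f p2"
    unfolding eq exp_utility_mixture[OF m] using assms by (simp add: exp_utility_posted)
  show "exp_surplus f vbar (two_price_alloc \<alpha> p1 p2)
      = \<alpha> * price_surplus f p1 + (1 - \<alpha>) * price_surplus f p2"
    unfolding eq exp_surplus_mixture[OF m] using assms by (simp add: exp_surplus_posted)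
qed

section \<open>Optimal mechanisms and the optimal value\<close>

lemma two_price_optimal:
  assumes c: "0 \<le> c" "c < expect f vbar (\<lambda>v. v)"
  obtains p1 p2 \<alpha> where "p1 \<in> {0..vbar}" "p2 \<in> {0..vbar}" "p1 \<le> p2" "\<alpha> \<in> {0..1}"
    "optimal f vbar c (two_price_alloc \<alpha> p1 p2) (two_price_payment \<alpha> p1 p2)"
    "exp_utility f vbar (two_price_alloc \<alpha> p1 p2) (two_price_payment \<alpha> p1 p2) = c"
proof (cases "c = 0")
  case True
  \<comment> \<open>The price \<open>vbar\<close> sells to no type in the interval; both prices
    coincide, so the weight 0 is an arbitrary choice.\<close>
  note t = mechanism_two_price[of vbar vbar 0]
  show thesis
    by (rule that[of vbar vbar 0])
      (use True vbar_pos t feasible_0_exp_surplus_le in \<open>auto simp: optimal_def feasible_iff price_vbar\<close>)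
next
  case False
  have anti: "antimono_on {0..vbar} (price_utility f)"
    using price_utility_strict_antimono by (auto intro!: monotone_onI simp: le_less)
  obtain p1 p2 \<alpha> lam where p: "p1 \<in> {0..vbar}" "p2 \<in> {0..vbar}" "p1 \<le> p2" "\<alpha> \<in> {0..1}" "0 \<le> lam"
    and eq: "\<alpha> * price_utility f p1 + (1 - \<alpha>) * price_utility f p2 = c"
    and bound: "\<And>q. q \<in> {0..vbar} \<Longrightarrow> price_surplus f q - lam * price_utility f q
      \<le> (\<alpha> * price_surplus f p1 + (1 - \<alpha>) * price_surplus f p2) - lam * c"
  proof (rule two_point_multiplier[OF continuous_on_price_utility continuous_on_price_surplus _ anti])
    show "price_surplus f q \<le> price_surplus f 0" if "q \<in> {0..vbar}" for q
      using exp_surplus_le_expect[OF mechanism_posted, of q] exp_surplus_posted[OF that] by (simp add: price_surplus_0)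
  qed (use c False vbar_pos in \<open>auto simp: price_vbar price_utility_0\<close>)
  note t = mechanism_two_price[OF p(1-4)]
  have "exp_surplus f vbar x \<le> \<alpha> * price_surplus f p1 + (1 - \<alpha>) * price_surplus f p2"
    if "feasible f vbar c x q" for x q
  proof -
    have "mechanism vbar x q" "exp_utility f vbar x q \<le> c" using that by (auto simp: feasible_iff)
    then show ?thesis
      \<comment> \<open>Since \<open>lam \<ge> 0\<close>, the utility bound absorbs the term
        \<open>- lam * c\<close> in the supporting line.\<close>
      using exp_surplus_le_multiplier[OF _ p(5) bound, of x q] mult_left_mono[OF _ p(5), of "exp_utility f vbar x q" c] by simp
  qed
  with t eq p show thesis by (intro that[of p1 p2 \<alpha>]) (auto simp: optimal_def feasible_iff)
qed

text \<open>Concavity at the two utilities of an optimal randomization shows that its surplus is at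
  most that of the single price with utility \<open>c\<close>.\<close>

lemma posted_optimal:
  assumes c: "0 \<le> c" "c < expect f vbar (\<lambda>v. v)"
    and conc: "concave_on {0..expect f vbar (\<lambda>v. v)} (surplus_of_utility f vbar)"
  obtains q where "q \<in> {0..vbar}" "optimal f vbar c (posted_alloc q) (posted_payment q)"
    "exp_utility f vbar (posted_alloc q) (posted_payment q) = c"
proof -
  obtain p1 p2 \<alpha> where p: "p1 \<in> {0..vbar}" "p2 \<in> {0..vbar}" "p1 \<le> p2" "\<alpha> \<in> {0..1}"
    and opt: "optimal f vbar c (two_price_alloc \<alpha> p1 p2) (two_price_payment \<alpha> p1 p2)"
    and eq: "exp_utility f vbar (two_price_alloc \<alpha> p1 p2) (two_price_payment \<alpha> p1 p2) = c"
    using two_price_optimal[OF c] .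
  note t = mechanism_two_price[OF p]
  have inj: "inj_on (price_utility f) {0..vbar}"
    using price_utility_strict_antimono by (intro linorder_inj_onI) fastforce+
  have SU: "surplus_of_utility f vbar (price_utility f q) = price_surplus f q" if "q \<in> {0..vbar}" for q
    unfolding surplus_of_utility_def price_of_utility_def using the_inv_into_f_f[OF inj that] by simp
  have range: "price_utility f q \<in> {0..expect f vbar (\<lambda>v. v)}" if "q \<in> {0..vbar}" for q
    using price_utility_strict_antimono[of 0 q] price_utility_strict_antimono[of q vbar] that vbar_pos
    by (cases "q = 0"; cases "q = vbar") (auto simp: price_utility_0 price_vbar)
  obtain q where q: "q \<in> {0..vbar}" "price_utility f q = c"
    using IVT2'[of "price_utility f" vbar c 0] c vbar_pos continuous_on_price_utility
    by (auto simp: price_utility_0 price_vbar)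
  have "\<alpha> * price_surplus f p1 + (1 - \<alpha>) * price_surplus f p2
      \<le> surplus_of_utility f vbar (\<alpha> * price_utility f p1 + (1 - \<alpha>) * price_utility f p2)"
    using conc range[OF p(1)] range[OF p(2)] p(4) unfolding concave_on_iff SU[OF p(1), symmetric] SU[OF p(2), symmetric]
    by auto
  then have "exp_surplus f vbar (two_price_alloc \<alpha> p1 p2) \<le> price_surplus f q"
    using t eq SU[OF q(1)] q(2) by simp
  with opt have "optimal f vbar c (posted_alloc q) (posted_payment q)"
    using q exp_surplus_posted[OF q(1)] exp_utility_posted[OF q(1)] mechanism_posted
    by (fastforce simp: optimal_def feasible_iff)
  with q show thesis by (intro that[of q]) (auto simp: exp_utility_posted)
qed

text \<open>Selling to every type attains the upper bound \<open>E[v]\<close> on surplus. The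
  condition \<open>k \<le> 0\<close> is individual rationality at type 0, and the lower bound on
  \<open>k\<close> is the utility constraint.\<close>

lemma give_to_all_optimal:
  assumes k: "k \<in> {- c + expect f vbar (\<lambda>v. v)..0}" and xp: "\<And>v. v \<in> {0..vbar} \<Longrightarrow> x v = 1 \<and> p v = k"
  shows "optimal f vbar c x p" and "exp_utility f vbar x p = expect f vbar (\<lambda>v. v) - k"
proof -
  have m: "mechanism vbar x p"
    using xp k by (auto simp: mechanism_def incentive_compatible_def individually_rational_def)
  have "exp_utility f vbar x p = expect f vbar (\<lambda>v. 1 * v + (- k) * 1)"
    unfolding exp_utility_def by (rule expect_cong) (simp add: xp)
  also have "\<dots> = expect f vbar (\<lambda>v. v) - k"
    using set_integrable_vf[of 0] set_integrable_f[of 0 vbar]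
    by (subst expect_linear) (simp_all add: expect_1)
  finally show u: "exp_utility f vbar x p = expect f vbar (\<lambda>v. v) - k" .
  have "exp_surplus f vbar x = expect f vbar (\<lambda>v. v)"
    unfolding exp_surplus_def by (rule expect_cong) (simp add: xp)
  then show "optimal f vbar c x p"
    using m u k exp_surplus_le_expect by (auto simp: optimal_def feasible_iff)
qed

text \<open>Besides the equality in the utility bound, this yields an optimum for every nonnegative
  bound, so that the optimal value is attained.\<close>

lemma binding_optimum:
  assumes "0 \<le> c"
  obtains x p where "optimal f vbar c x p" "exp_utility f vbar x p = c"
proof (cases "c < expect f vbar (\<lambda>v. v)")
  case True
  then show thesis using two_price_optimal[OF assms] that by metis
next
  case False
  then show thesis
    \<comment> \<open>The lowest admissible payment hands out all the utility that the bound
      \<open>c\<close> leaves.\<close>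
    using give_to_all_optimal[of "- c + expect f vbar (\<lambda>v. v)" c "\<lambda>_. 1" "\<lambda>_. - c + expect f vbar (\<lambda>v. v)"] that
    by auto
qed

lemma opt_value_eq: "optimal f vbar c x p \<Longrightarrow> opt_value f vbar c = exp_surplus f vbar x"
  unfolding opt_value_def optimal_def by (rule cSup_eq_maximum) auto

text \<open>Surplus and utility are affine under mixing, so mixing optima for \<open>c\<close> and
  \<open>d\<close> gives a feasible mechanism for the mixed bound.\<close>

lemma concave_on_opt_value: "concave_on {0..} (opt_value f vbar)"
  unfolding concave_on_iff
proof (intro conjI ballI allI impI)
  fix c d s t :: real
  assume c: "c \<in> {0..}" and d: "d \<in> {0..}" and s: "0 \<le> s" "0 \<le> t" "s + t = 1"
  obtain x p where x: "optimal f vbar c x p" using binding_optimum[of c] c by (metis atLeast_iff)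
  obtain x' p' where x': "optimal f vbar d x' p'" using binding_optimum[of d] d by (metis atLeast_iff)
  have "0 \<le> s * c + t * d" using c d s by simp
  then obtain y r where y: "optimal f vbar (s * c + t * d) y r" by (rule binding_optimum)
  have t: "t = 1 - s" using s by simp
  have m: "mechanism vbar x p" "mechanism vbar x' p'"
    and u: "exp_utility f vbar x p \<le> c" "exp_utility f vbar x' p' \<le> d"
    using x x' by (auto simp: optimal_def feasible_iff)
  have "feasible f vbar (s * c + t * d) (\<lambda>v. s * x v + (1 - s) * x' v) (\<lambda>v. s * p v + (1 - s) * p' v)"
    unfolding feasible_iff exp_utility_mixture[OF m] using u s
    by (auto simp: t intro!: mechanism_mixture[OF m] add_mono mult_left_mono)
  with y have "exp_surplus f vbar (\<lambda>v. s * x v + (1 - s) * x' v) \<le> exp_surplus f vbar y"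
    by (auto simp: optimal_def)
  then show "s * opt_value f vbar c + t * opt_value f vbar d \<le> opt_value f vbar (s *\<^sub>R c + t *\<^sub>R d)"
    using opt_value_eq[OF x] opt_value_eq[OF x'] opt_value_eq[OF y] by (simp add: exp_surplus_mixture[OF m] t)
qed simp

end

theorem lemma18:
  fixes f :: "real \<Rightarrow> real" and vbar c :: real
  assumes "0 < vbar"
    and "density_with_support f vbar"
    and "0 \<le> c"
  shows "(expect f vbar (\<lambda>v. v) \<le> c \<longrightarrow>
            (\<forall>x p. \<forall>k\<in>{- c + expect f vbar (\<lambda>v. v)..0}.
               (\<forall>v\<in>{0..vbar}. x v = 1 \<and> p v = k) \<longrightarrow> optimal f vbar c x p))
       \<and> (c < expect f vbar (\<lambda>v. v) \<longrightarrow>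
            (\<exists>p1\<in>{0..vbar}. \<exists>p2\<in>{0..vbar}. \<exists>\<alpha>\<in>{0..1}. p1 \<le> p2 \<and>
               optimal f vbar c (two_price_alloc \<alpha> p1 p2) (two_price_payment \<alpha> p1 p2) \<and>
               exp_utility f vbar (two_price_alloc \<alpha> p1 p2) (two_price_payment \<alpha> p1 p2) = c))
       \<and> (c < expect f vbar (\<lambda>v. v) \<and>
            concave_on {0..expect f vbar (\<lambda>v. v)} (surplus_of_utility f vbar) \<longrightarrow>
            (\<exists>q\<in>{0..vbar}. optimal f vbar c (posted_alloc q) (posted_payment q) \<and>
               exp_utility f vbar (posted_alloc q) (posted_payment q) = c))
       \<and> (\<exists>x p. optimal f vbar c x p \<and> exp_utility f vbar x p = c)
       \<and> concave_on {0..} (opt_value f vbar)"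
proof -
  interpret value_density f vbar using assms by unfold_locales
  show ?thesis
  proof (intro conjI)
    show "expect f vbar (\<lambda>v. v) \<le> c \<longrightarrow>
            (\<forall>x p. \<forall>k\<in>{- c + expect f vbar (\<lambda>v. v)..0}.
               (\<forall>v\<in>{0..vbar}. x v = 1 \<and> p v = k) \<longrightarrow> optimal f vbar c x p)"
      using give_to_all_optimal(1) by blast
    show "c < expect f vbar (\<lambda>v. v) \<longrightarrow>
            (\<exists>p1\<in>{0..vbar}. \<exists>p2\<in>{0..vbar}. \<exists>\<alpha>\<in>{0..1}. p1 \<le> p2 \<and>
               optimal f vbar c (two_price_alloc \<alpha> p1 p2) (two_price_payment \<alpha> p1 p2) \<and>
               exp_utility f vbar (two_price_alloc \<alpha> p1 p2) (two_price_payment \<alpha> p1 p2) = c)"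
      using two_price_optimal[OF assms(3)] by metis
    show "c < expect f vbar (\<lambda>v. v) \<and>
            concave_on {0..expect f vbar (\<lambda>v. v)} (surplus_of_utility f vbar) \<longrightarrow>
            (\<exists>q\<in>{0..vbar}. optimal f vbar c (posted_alloc q) (posted_payment q) \<and>
               exp_utility f vbar (posted_alloc q) (posted_payment q) = c)"
      using posted_optimal[OF assms(3)] by metis
    show "\<exists>x p. optimal f vbar c x p \<and> exp_utility f vbar x p = c"
      using binding_optimum[OF assms(3)] by metis
  qed (rule concave_on_opt_value)
qed

end
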